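(* Let $F$ be a non-archimedean local field of characteristic different from $2$, let $E/F$ be a quadratic extension with non-trivial automorphism $x\mapsto\overline{x}$ (applied entrywise to matrices), let $n\geq 1$, and set \[G=\left\{\begin{pmatrix}\alpha&\beta\\ \overline{\beta}&\overline{\alpha}\end{pmatrix}\in \operatorname{GL}_{2n}(E):\ \alpha,\beta\in\mathcal{M}_n(E)\right\},\qquad H=\left\{\begin{pmatrix}\alpha&0\\ 0&\overline{\alpha}\end{pmatrix}\in G\right\}.\] If $g\in G$, then $g^{-1}\in HgH$.
   Context: This is a concrete realization of the pair $(\operatorname{GL}_{2n}(F),\operatorname{GL}_n(E))$, where $\operatorname{GL}_n(E)$ is the centralizer in $\operatorname{GL}_{2n}(F)$ of $E^\times$, with $E$ embedded in $\mathcal{M}_{2n}(F)$ as an $F$-subalgebra. *)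

theory Defs
  imports
    "HOL-Analysis.Abstract_Metric_Spaces"
    "HOL-Algebra.Coset"
    "Jordan_Normal_Form.Ring_Hom_Matrix"
begin

text \<open>A non-archimedean local field is a field that is locally compact for the topology of a
  non-trivial ultrametric absolute value; discreteness of the valuation, completeness and
  finiteness of the residue field are consequences.\<close>

locale nonarch_local_field =
  fixes absv :: "'f::field \<Rightarrow> real"
  assumes absv_nonneg: "absv x \<ge> 0"
    and absv_eq_0_iff: "absv x = 0 \<longleftrightarrow> x = 0"
    and absv_mult: "absv (x * y) = absv x * absv y"
    and absv_ultrametric: "absv (x + y) \<le> max (absv x) (absv y)"
    and absv_nontrivial: "\<exists>x. x \<noteq> 0 \<and> absv x \<noteq> 1"
    and locally_compact:
      "locally_compact_space (Metric_space.mtopology UNIV (\<lambda>x y. absv (x - y)))"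

text \<open>The extension is given by an embedding, through which the larger field is a vector space
  over the smaller one. The library's dimension is 0 for spaces of infinite dimension, so the value
  2 also expresses finite-dimensionality.\<close>

locale quadratic_extension = field_hom emb
  for emb :: "'f::field \<Rightarrow> 'e::field" +
  assumes degree: "vector_space.dim (\<lambda>a x. emb a * x) (UNIV :: 'e set) = 2"

locale quadratic_extension_conj = quadratic_extension emb + bar: field_hom bar
  for emb :: "'f::field \<Rightarrow> 'e::field" and bar :: "'e \<Rightarrow> 'e" +
  assumes bar_bij: "bij bar"
    and bar_emb: "bar (emb a) = emb a"
    and bar_nontrivial: "bar \<noteq> id"

definition GL :: "'a::field itself \<Rightarrow> nat \<Rightarrow> 'a mat monoid" where
  "GL ty m = units_of (ring_mat ty m ())"

definition G_set :: "('e::field \<Rightarrow> 'e) \<Rightarrow> nat \<Rightarrow> 'e mat set" where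
  "G_set bar n =
    {four_block_mat \<alpha> \<beta> (map_mat bar \<beta>) (map_mat bar \<alpha>) | \<alpha> \<beta>.
       \<alpha> \<in> carrier_mat n n \<and> \<beta> \<in> carrier_mat n n} \<inter> carrier (GL TYPE('e) (2 * n))"

definition H_set :: "('e::field \<Rightarrow> 'e) \<Rightarrow> nat \<Rightarrow> 'e mat set" where
  "H_set bar n =
    {four_block_mat \<alpha> (0\<^sub>m n n) (0\<^sub>m n n) (map_mat bar \<alpha>) | \<alpha>.
       \<alpha> \<in> carrier_mat n n} \<inter> G_set bar n"

definition double_coset :: "('a, 'b) monoid_scheme \<Rightarrow> 'a set \<Rightarrow> 'a \<Rightarrow> 'a set" where
  "double_coset K H g = (H #>\<^bsub>K\<^esub> g) <#>\<^bsub>K\<^esub> H"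

end

theory Submission
  imports
    Defs
    "HOL-Library.Function_Algebras"
    "Jordan_Normal_Form.Determinant"
begin

text \<open>The matrix \<open>g\<close> with blocks \<open>\<alpha>\<close> and \<open>\<beta>\<close> is the operator \<open>a + b\<close> on \<open>E\<^sup>n\<close>, where
  \<open>a v = \<alpha> v\<close> is linear and \<open>b v = \<beta> bar v\<close> is antilinear. The key point is an invertible
  linear \<open>w\<close> with \<open>a w b = b w a\<close>: if \<open>\<delta>\<close> is skew under the bar and \<open>x\<close> is the matrix of \<open>\<delta> w\<close>, this
  equation says that the off-diagonal blocks of \<open>g k g\<close> vanish for \<open>k = diag(x, bar x)\<close>, so
  \<open>g k g = h\<close> with \<open>h \<in> H\<close> and \<open>g\<^sup>-\<^sup>1 = h\<^sup>-\<^sup>1 g k\<close>.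

  If \<open>a\<close> is bijective, \<open>w = a\<^sup>-\<^sup>1\<close> works. In general \<open>w\<close> is built by induction for
  \<open>a, b : V \<rightarrow> V'\<close> with \<open>a + b\<close> onto and \<open>dim V \<le> dim V'\<close>: both maps restrict to
  \<open>V1 = {v \<in> V. b v \<in> a V} \<rightarrow> a V\<close>, again with \<open>a + b\<close> onto, and a solution for the restriction
  extends to \<open>V'\<close>.\<close>

section \<open>Bases, and pairs of a linear and an antilinear map\<close>

lemma (in vector_space) subspace_basis:
  assumes "subspace S" "S \<subseteq> span F" "finite F"
  obtains B where "finite B" "independent B" "span B = S" "card B \<le> card F"
proof -
  obtain B where B: "B \<subseteq> S" "independent B" "S \<subseteq> span B"
    using maximal_independent_subset[of S] by blast
  have "finite B \<and> card B \<le> card F"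
    using independent_span_bound[OF assms(3) B(2)] B(1) assms(2) by blast
  moreover have "span B = S"
    using B span_minimal[OF B(1) assms(1)] by auto
  ultimately show ?thesis using that B by blast
qed

text \<open>Both maps are total on one ambient space that contains \<open>V\<close> and
  \<open>V'\<close>, so the induction passes to restrictions without changing \<open>a\<close> or
  \<open>b\<close>.\<close>

locale antilinear_pair = vector_space scale
  for scale :: "'k::field \<Rightarrow> 'v::ab_group_add \<Rightarrow> 'v" (infixr "*s" 75) +
  fixes \<sigma> :: "'k \<Rightarrow> 'k" and a b :: "'v \<Rightarrow> 'v"
  assumes surj: "surj \<sigma>"
    and linear_a: "Vector_Spaces.linear scale scale a"
    and b_add: "b (x + y) = b x + b y"
    and b_scale: "b (c *s x) = \<sigma> c *s b x"
begin

sublocale endo: vector_space_pair scale scale ..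

lemma b_zero [simp]: "b 0 = 0"
  using b_add[of 0 0] by simp

lemma b_diff: "b (x - y) = b x - b y"
  using b_add[of "x - y" y] by (simp add: algebra_simps)

lemmas a_simps = endo.linear_0[OF linear_a] endo.linear_add[OF linear_a] endo.linear_scale[OF linear_a]
  endo.linear_diff[OF linear_a]

lemma subspace_vimage_b:
  assumes "subspace U"
  shows "subspace {v. b v \<in> U}"
  using assms by (auto simp: subspace_def b_add b_scale)

text \<open>The set is b(S) + U. Closure under scalars rests on surjectivity of
  \<open>\<sigma>\<close>: if \<open>\<sigma> d = c\<close>, then
  \<open>c *s b v = b (d *s v)\<close>.\<close>

lemma subspace_b_image_plus:
  assumes "subspace S" "subspace U"
  shows "subspace {x. \<exists>v\<in>S. x - b v \<in> U}"
proof (rule subspaceI)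
  show "0 \<in> {x. \<exists>v\<in>S. x - b v \<in> U}"
    using subspace_0[OF assms(1)] subspace_0[OF assms(2)] by force
next
  fix x y assume "x \<in> {x. \<exists>v\<in>S. x - b v \<in> U}" "y \<in> {x. \<exists>v\<in>S. x - b v \<in> U}"
  then obtain v u where "v \<in> S" "u \<in> S" "x - b v \<in> U" "y - b u \<in> U" by blast
  then have "v + u \<in> S" "(x + y) - b (v + u) \<in> U"
    using subspace_add[OF assms(1)] subspace_add[OF assms(2), of "x - b v" "y - b u"]
    by (auto simp: b_add algebra_simps)
  then show "x + y \<in> {x. \<exists>v\<in>S. x - b v \<in> U}" by blast
next
  fix c x assume "x \<in> {x. \<exists>v\<in>S. x - b v \<in> U}"
  then obtain v where v: "v \<in> S" "x - b v \<in> U" by blast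
  obtain d where d: "\<sigma> d = c" using surj by (metis surjD)
  have "d *s v \<in> S" "c *s x - b (d *s v) \<in> U"
    using v subspace_scale[OF assms(1)] subspace_scale[OF assms(2), of "x - b v" c]
    by (auto simp: b_scale d scale_right_diff_distrib)
  then show "c *s x \<in> {x. \<exists>v\<in>S. x - b v \<in> U}" by blast
qed

text \<open>Surjectivity and the dimension bound make \<open>a\<close> bijective from
  \<open>V\<close> to \<open>V'\<close>. With \<open>w\<close> its inverse there, both sides reduce
  to \<open>b v\<close>.\<close>

lemma intertwiner_if_surj:
  assumes B: "finite B" "independent B" "span B = V"
    and B': "finite B'" "independent B'" "span B' = V'"
    and card: "card B \<le> card B'"
    and a_surj: "a ` V = V'"
  shows "\<exists>w. Vector_Spaces.linear scale scale w \<and> w ` V' = V \<and>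
    (\<forall>v\<in>V. b v \<in> V' \<longrightarrow> a (w (b v)) = b (w (a v)))"
proof -
  have "\<forall>x\<in>B'. \<exists>v. v \<in> V \<and> a v = x"
  proof
    fix x assume "x \<in> B'"
    then have "x \<in> a ` V" using a_surj B'(3) span_base[of x B'] by simp
    then show "\<exists>v. v \<in> V \<and> a v = x" by blast
  qed
  then obtain p where p: "\<And>x. x \<in> B' \<Longrightarrow> p x \<in> V \<and> a (p x) = x"
    by metis
  obtain w where w: "Vector_Spaces.linear scale scale w" "\<And>x. x \<in> B' \<Longrightarrow> w x = p x"
    using endo.linear_independent_extend[OF B'(2)] by metis
  have aw: "a (w x) = x" if "x \<in> V'" for x
  proof -
    have "B' \<subseteq> {x. a (w x) = x}" using w(2) p by auto
    moreover have "subspace {x. a (w x) = x}"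
      by (auto simp: subspace_def a_simps endo.linear_0[OF w(1)] endo.linear_add[OF w(1)]
          endo.linear_scale[OF w(1)])
    ultimately show ?thesis using span_minimal[of B'] B'(3) that by blast
  qed
  have inj: "inj_on w V'"
    using aw by (metis inj_onI)
  have wV': "w ` V' = span (w ` B')"
    using endo.linear_span_image[OF w(1)] B'(3) by metis
  have ind: "independent (w ` B')"
    using endo.linear_independent_injective_image[OF w(1) B'(2)] inj B'(3) by blast
  have sub: "w ` B' \<subseteq> V"
    using w(2) p by auto
  \<comment> \<open>The image of \<open>B'\<close> under \<open>w\<close> is independent with at
    least \<open>card B\<close> elements, so one more independent vector of \<open>V\<close> would
    exceed the dimension.\<close>
  have "V \<subseteq> span (w ` B')"
  proof
    fix v assume v: "v \<in> V"
    show "v \<in> span (w ` B')"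
    proof (rule ccontr)
      assume nv: "v \<notin> span (w ` B')"
      then have "independent (insert v (w ` B'))"
        using ind independent_insertI[of v "w ` B'"] by simp
      then have "card (insert v (w ` B')) \<le> card B"
        using independent_span_bound[OF B(1), of "insert v (w ` B')"] sub v B(3) by auto
      moreover have "card (w ` B') = card B'"
        using inj_on_subset[OF inj] B'(3) span_superset[of B'] by (simp add: card_image)
      moreover have "v \<notin> w ` B'" using nv span_base[of v "w ` B'"] by auto
      ultimately show False using card B'(1) by simp
    qed
  qed
  moreover have "span (w ` B') \<subseteq> V"
    using span_minimal[OF sub] B(3) subspace_span[of B] by simp
  ultimately have onto: "w ` V' = V" using wV' by blast
  have "w (a v) = v" if "v \<in> V" for v
    using that onto aw by (metis imageE)
  then show ?thesis using w(1) onto aw by auto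
qed

text \<open>The dimension bound is inherited by \<open>V1\<close> because \<open>b\<close> maps \<open>V/V1\<close> onto \<open>V'/a V\<close>.\<close>

lemma card_basis_vimage_le:
  assumes B: "finite B" "independent B" "span B = V"
    and B': "finite B'" "independent B'" "span B' = V'"
    and card: "card B \<le> card B'"
    and sum: "\<And>x. x \<in> V' \<Longrightarrow> \<exists>v\<in>V. a v + b v = x"
    and B1: "independent B1" "span B1 = {v \<in> V. b v \<in> a ` V}"
    and B1': "finite B1'" "span B1' = a ` V"
  shows "card B1 \<le> card B1'"
proof -
  have "B1 \<subseteq> V" using B1(2) span_superset[of B1] by auto
  \<comment> \<open>\<open>C\<close> is a basis of \<open>V\<close> through \<open>B1\<close>; its
    vectors outside \<open>B1\<close> represent a basis of V/V1.\<close>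
  then obtain C where C: "B1 \<subseteq> C" "C \<subseteq> V" "independent C" "V \<subseteq> span C"
    using maximal_independent_subset_extend[of B1 V] B1(1) by blast
  have finC: "finite C" "card C \<le> card B"
    using independent_span_bound[OF B(1) C(3)] C(2) B(3) by auto
  have finB1: "finite B1" using finC C(1) finite_subset by blast
  \<comment> \<open>As \<open>b\<close> sends \<open>B1\<close> into a(V), this set generates both
    a(V) and b(V), hence \<open>V'\<close>.\<close>
  let ?X = "B1' \<union> b ` (C - B1)"
  have "C \<subseteq> {v. b v \<in> span ?X}"
  proof
    fix v assume v: "v \<in> C"
    show "v \<in> {v. b v \<in> span ?X}"
    proof (cases "v \<in> B1")
      case True
      then have "b v \<in> span B1'" using B1(2) B1'(2) span_base[of v B1] by auto
      then show ?thesis using span_mono[of B1' ?X] by auto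
    next
      case False
      then show ?thesis using v by (auto intro!: span_base)
    qed
  qed
  then have bV: "V \<subseteq> {v. b v \<in> span ?X}"
    using span_minimal[OF _ subspace_vimage_b[OF subspace_span]] C(4) by (meson order_trans)
  have "B' \<subseteq> span ?X"
  proof
    fix x assume "x \<in> B'"
    then obtain v where v: "v \<in> V" "a v + b v = x"
      using sum B'(3) span_base[of x B'] by blast
    have "a v \<in> span ?X" using v(1) B1'(2) span_mono[of B1' ?X] by auto
    then have "a v + b v \<in> span ?X" using v(1) bV by (auto intro!: span_add)
    then show "x \<in> span ?X" using v(2) by simp
  qed
  then have "card B' \<le> card ?X"
    using independent_span_bound[of ?X, OF _ B'(2)] B1'(1) finC(1) by simp
  also have "\<dots> \<le> card B1' + card (b ` (C - B1))" by (rule card_Un_le)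
  also have "\<dots> \<le> card B1' + card (C - B1)" using finC(1) by (simp add: card_image_le)
  finally have "card B' \<le> card B1' + (card C - card B1)"
    using card_Diff_subset[OF finB1 C(1)] by simp
  \<comment> \<open>Natural subtraction truncates at 0, so \<open>card C - card B1\<close> is usable
    only with this bound.\<close>
  moreover have "card B1 \<le> card C" using card_mono[OF finC(1) C(1)] .
  ultimately show ?thesis using card finC(2) by linarith
qed

lemma subspace_a_image: "subspace S \<Longrightarrow> subspace (a ` S)"
  using endo.linear_subspace_image[OF linear_a] .

text \<open>The basis of \<open>V'\<close> is adapted to \<open>a V \<subseteq> a V + b (ker a) \<subseteq> a V + b V = V'\<close>. On a new vector \<open>b v\<close>
  the equation only prescribes \<open>w (b v)\<close> modulo \<open>ker a\<close>; for \<open>v \<in> ker a\<close> the choice \<open>w (b v) = v\<close>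
  makes \<open>w\<close> reach \<open>ker a\<close>, which together with \<open>a (w V') = a V\<close> gives surjectivity.\<close>

lemma intertwiner_extend:
  assumes V: "subspace V" and V': "subspace V'" and aV: "a ` V \<subseteq> V'" and bV: "b ` V \<subseteq> V'"
    and sum: "\<And>x. x \<in> V' \<Longrightarrow> \<exists>v\<in>V. a v + b v = x"
    and V1: "V1 = {v \<in> V. b v \<in> a ` V}"
    and w1: "Vector_Spaces.linear scale scale w1" "w1 ` a ` V = V1"
      "\<And>v. v \<in> V1 \<Longrightarrow> a (w1 (b v)) = b (w1 (a v))"
  shows "\<exists>w. Vector_Spaces.linear scale scale w \<and> w ` V' = V \<and>
    (\<forall>v\<in>V. a (w (b v)) = b (w (a v)))"
proof -
  define U where "U = a ` V"
  define K where "K = {v \<in> V. a v = 0}"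
  have U: "subspace U" unfolding U_def by (rule subspace_a_image[OF V])
  have K: "subspace K"
    using V by (auto simp: K_def subspace_def a_simps)
  have V1V: "V1 \<subseteq> V" using V1 by auto
  have UV': "U \<subseteq> V'" using aV U_def by auto
  have w1U: "w1 (a v) \<in> V1" if "v \<in> V" for v using that w1(2) by auto
  obtain B where B: "B \<subseteq> U" "independent B" "U \<subseteq> span B"
    using maximal_independent_subset by blast
  obtain C where C: "B \<subseteq> C" "C \<subseteq> U \<union> b ` K" "independent C" "U \<union> b ` K \<subseteq> span C"
  proof -
    have "B \<subseteq> U \<union> b ` K" using B(1) by auto
    then show ?thesis using maximal_independent_subset_extend[OF _ B(2)] that by metis
  qed
  obtain D where D: "C \<subseteq> D" "D \<subseteq> U \<union> b ` V" "independent D" "U \<union> b ` V \<subseteq> span D"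
  proof -
    have "C \<subseteq> U \<union> b ` V" using C(2) K_def by auto
    then show ?thesis using maximal_independent_subset_extend[OF _ C(3)] that by metis
  qed
  \<comment> \<open>\<open>B\<close> already spans \<open>U\<close> and \<open>D\<close> is
    independent. Hence the vectors of \<open>C\<close> outside \<open>B\<close> come from b(K) and
    those of \<open>D\<close> outside \<open>C\<close> from b(V).\<close>
  have new: "x \<notin> U" if "x \<in> D" "x \<notin> B" for x
  proof
    assume "x \<in> U"
    then have "x \<in> span (D - {x})"
      using B(3) C(1) D(1) that span_mono[of B "D - {x}"] by blast
    then show False using D(3) that(1) by (auto simp: dependent_def)
  qed
  have DV': "D \<subseteq> V'" using D(2) UV' bV by blast
  have spanD: "span D = V'"
  proof
    show "span D \<subseteq> V'" by (rule span_minimal[OF DV' V'])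
    show "V' \<subseteq> span D"
    proof
      fix x assume "x \<in> V'"
      then obtain v where v: "v \<in> V" "a v + b v = x" using sum by blast
      then have "a v \<in> span D" "b v \<in> span D" using D(4) U_def by auto
      then show "x \<in> span D" using v(2) span_add by blast
    qed
  qed
  \<comment> \<open>\<open>P x y\<close> says that \<open>y\<close> is an admissible value of
    \<open>w\<close> at the basis vector \<open>x\<close>; its last case is the required equation at
    \<open>v\<close>, with \<open>w1\<close> for \<open>w\<close> on \<open>U\<close>.\<close>
  define P where "P = (\<lambda>x y. y \<in> V \<and> (if x \<in> B then y = w1 x
    else if x \<in> C then a y = 0 \<and> b y = x
    else \<exists>v\<in>V. x = b v \<and> a y = b (w1 (a v))))"
  have "\<exists>y. P x y" if x: "x \<in> D" for x
  proof -
    consider "x \<in> B" | "x \<notin> B" "x \<in> C" | "x \<notin> B" "x \<notin> C" by blast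
    then show ?thesis
    proof cases
      case 1
      then have "w1 x \<in> V" using B(1) w1(2) V1V unfolding U_def by blast
      then show ?thesis using 1 unfolding P_def by auto
    next
      case 2
      then have "x \<in> b ` K" using C(2) new[OF x] by blast
      then show ?thesis using 2 unfolding P_def K_def by auto
    next
      case 3
      then have "x \<in> b ` V" using D(2) new[OF x] x by blast
      then obtain v where v: "v \<in> V" "x = b v" by blast
      \<comment> \<open>Solvability is the definition of \<open>V1\<close>: \<open>b\<close> sends
        \<open>w1 (a v)\<close>, an element of \<open>V1\<close>, into a(V).\<close>
      have "b (w1 (a v)) \<in> a ` V" using w1U[OF v(1)] V1 by auto
      then obtain y where "y \<in> V" "b (w1 (a v)) = a y" by blast
      then show ?thesis using 3 v unfolding P_def by metis
    qed
  qed
  then obtain f where f: "\<And>x. x \<in> D \<Longrightarrow> P x (f x)" by metis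
  obtain w where w: "Vector_Spaces.linear scale scale w" "\<And>x. x \<in> D \<Longrightarrow> w x = f x"
    using endo.linear_independent_extend[OF D(3)] by metis
  note w_simps = endo.linear_0[OF w(1)] endo.linear_add[OF w(1)] endo.linear_scale[OF w(1)]
    endo.linear_diff[OF w(1)]
  have Pw: "P x (w x)" if "x \<in> D" for x using f w(2) that by simp
  have wU: "w x = w1 x" if "x \<in> U" for x
  proof (rule endo.linear_eq_on[OF w(1) w1(1), of x B])
    show "x \<in> span B" using that B(3) by blast
    show "w y = w1 y" if "y \<in> B" for y
      using Pw[of y] that C(1) D(1) unfolding P_def by auto
  qed
  have wa: "w (a v) = w1 (a v)" if "v \<in> V" for v using wU that unfolding U_def by blast
  \<comment> \<open>The equation holds on all of \<open>V\<close> once \<open>S\<close> contains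
    \<open>V1\<close> and b(S) + U contains \<open>V'\<close>.\<close>
  define S where "S = {v \<in> V. a (w (b v)) = b (w (a v))}"
  have S: "subspace S"
    using V by (auto simp: S_def subspace_def a_simps w_simps b_add b_scale)
  have V1S: "V1 \<subseteq> S"
  proof
    fix v assume v: "v \<in> V1"
    then have "v \<in> V" "b v \<in> U" using V1 U_def by auto
    then show "v \<in> S" using w1(3)[OF v] wU wa unfolding S_def by auto
  qed
  have into: "w ` V' \<subseteq> V"
  proof -
    have "D \<subseteq> {x. w x \<in> V}" using Pw unfolding P_def by blast
    moreover have "subspace {x. w x \<in> V}"
      using V by (auto simp: subspace_def w_simps)
    ultimately have "V' \<subseteq> {x. w x \<in> V}" using span_minimal spanD by blast
    then show ?thesis by blast
  qed
  have "D \<subseteq> {x. \<exists>v\<in>S. x - b v \<in> U}"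
  proof
    fix x assume x: "x \<in> D"
    consider "x \<in> B" | "x \<notin> B" "x \<in> C" | "x \<notin> B" "x \<notin> C" by blast
    then show "x \<in> {x. \<exists>v\<in>S. x - b v \<in> U}"
    proof cases
      case 1
      then show ?thesis using B(1) subspace_0[OF S] by force
    next
      case 2
      then have y: "w x \<in> V" "a (w x) = 0" "b (w x) = x"
        using Pw[OF x] unfolding P_def by auto
      \<comment> \<open>Both sides of the equation at \<open>w x\<close> vanish: the left one is
        \<open>a (w x)\<close>, the right one \<open>b (w 0)\<close>.\<close>
      then have "w x \<in> S" unfolding S_def by (simp add: w_simps)
      then show ?thesis using y subspace_0[OF U] by force
    next
      case 3
      then obtain v where v: "v \<in> V" "x = b v" "a (w x) = b (w1 (a v))"
        using Pw[OF x] unfolding P_def by auto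
      then have "v \<in> S" using wa unfolding S_def by auto
      then show ?thesis using v subspace_0[OF U] by force
    qed
  qed
  then have V'S: "V' \<subseteq> {x. \<exists>v\<in>S. x - b v \<in> U}"
    using span_minimal[OF _ subspace_b_image_plus[OF S U]] spanD by blast
  have VS: "V \<subseteq> S"
  proof
    fix v assume v: "v \<in> V"
    then obtain u where u: "u \<in> S" "b v - b u \<in> U" using V'S bV by blast
    then have "v - u \<in> V1"
      using v V subspace_diff unfolding V1 U_def S_def by (auto simp: b_diff)
    then have "(v - u) + u \<in> S" using V1S u(1) subspace_add[OF S] by blast
    then show "v \<in> S" by simp
  qed
  define W where "W = w ` V'"
  have W: "subspace W" unfolding W_def by (rule endo.linear_subspace_image[OF w(1) V'])
  have V1W: "V1 \<subseteq> W"
  proof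
    fix v assume "v \<in> V1"
    then obtain x where "x \<in> V" "v = w1 (a x)" using w1(2) by blast
    then show "v \<in> W" using wa UV' unfolding W_def U_def by (metis imageI subsetD)
  qed
  \<comment> \<open>The argument used for \<open>S\<close> is repeated inside the kernel, with the
    kernel vectors that \<open>w\<close> reaches in place of \<open>S\<close>.\<close>
  have "C \<subseteq> {x. \<exists>v\<in>K \<inter> W. x - b v \<in> U}"
  proof
    fix x assume x: "x \<in> C"
    show "x \<in> {x. \<exists>v\<in>K \<inter> W. x - b v \<in> U}"
    proof (cases "x \<in> B")
      case True
      then show ?thesis using B(1) subspace_0[OF K] subspace_0[OF W] by force
    next
      case False
      then have "w x \<in> K" "b (w x) = x"
        using Pw[of x] x D(1) unfolding P_def K_def by auto
      moreover have "w x \<in> W" using x D(1) DV' unfolding W_def by blast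
      ultimately show ?thesis using subspace_0[OF U] by force
    qed
  qed
  then have CK: "span C \<subseteq> {x. \<exists>v\<in>K \<inter> W. x - b v \<in> U}"
    by (rule span_minimal[OF _ subspace_b_image_plus[OF subspace_inter[OF K W] U]])
  have KW: "K \<subseteq> W"
  proof
    fix v assume v: "v \<in> K"
    then obtain u where u: "u \<in> K" "u \<in> W" "b v - b u \<in> U" using CK C(4) by blast
    then have "v - u \<in> V1"
      using v V subspace_diff unfolding V1 U_def K_def by (auto simp: b_diff)
    then have "(v - u) + u \<in> W" using V1W u(2) subspace_add[OF W] by blast
    then show "v \<in> W" by simp
  qed
  have "V \<subseteq> W"
  proof
    fix v assume v: "v \<in> V"
    \<comment> \<open>The kernel is reached, so it suffices to find \<open>x\<close> in
      \<open>V'\<close> with \<open>a (w x) = a v\<close>. Splitting \<open>a v\<close> as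
      \<open>a z + b z\<close> puts \<open>b z\<close> into a(V), so \<open>z\<close> lies in
      \<open>V1\<close> and has the form \<open>w (a u)\<close>.\<close>
    then obtain z where z: "z \<in> V" "a z + b z = a v" using sum aV by blast
    have "b z = a (v - z)" using z(2) by (simp add: a_simps algebra_simps)
    then have "z \<in> V1" using z(1) v V subspace_diff unfolding V1 by auto
    then obtain u where u: "u \<in> V" "z = w (a u)" using w1(2) wa by (metis imageE)
    \<comment> \<open>Here \<open>a (w (a u)) = a z\<close> and, by the equation at
      \<open>u\<close>, \<open>a (w (b u)) = b z\<close>; the sum is \<open>a v\<close>.\<close>
    define x where "x = a u + b u"
    have x: "x \<in> V'" unfolding x_def using u(1) aV bV V' subspace_add by blast
    have "a (w (b u)) = b z" using VS u unfolding S_def by auto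
    then have "a (w x) = a v" unfolding x_def using z(2) u(2) by (simp add: a_simps w_simps)
    then have "v - w x \<in> K"
      using v into x V subspace_diff unfolding K_def by (auto simp: a_simps)
    moreover have "w x \<in> W" using x unfolding W_def by blast
    ultimately have "(v - w x) + w x \<in> W" using KW subspace_add[OF W] by blast
    then show "v \<in> W" by simp
  qed
  then have "w ` V' = V" using into unfolding W_def by blast
  then show ?thesis using w(1) VS unfolding S_def by blast
qed

text \<open>Induction on the dimension of \<open>V'\<close>. If \<open>a\<close> is not onto, a(V)
  is a smaller target for the restricted pair; \<open>card_basis_vimage_le\<close> preserves the
  dimension bound and \<open>intertwiner_extend\<close> leads back.\<close>

theorem intertwiner_exists:
  assumes "finite B" "independent B" "finite B'" "independent B'" "card B \<le> card B'"
    and "a ` span B \<subseteq> span B'" "b ` span B \<subseteq> span B'"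
    and "\<And>x. x \<in> span B' \<Longrightarrow> \<exists>v\<in>span B. a v + b v = x"
  shows "\<exists>w. Vector_Spaces.linear scale scale w \<and> w ` span B' = span B \<and>
    (\<forall>v\<in>span B. a (w (b v)) = b (w (a v)))"
  using assms
proof (induction "card B'" arbitrary: B B' rule: less_induct)
  case less
  let ?V = "span B" and ?V' = "span B'"
  show ?case
  proof (cases "a ` ?V = ?V'")
    case True
    then show ?thesis
      using intertwiner_if_surj[OF less.prems(1,2) refl less.prems(3,4) refl less.prems(5) True]
        less.prems(7) by (meson image_subset_iff)
  next
    case False
    define V1 where "V1 = {v \<in> ?V. b v \<in> a ` ?V}"
    have U: "subspace (a ` ?V)" by (rule subspace_a_image[OF subspace_span])
    have V1: "subspace V1"
      using subspace_inter[OF subspace_span[of B] subspace_vimage_b[OF U]]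
      unfolding V1_def Int_def by simp
    obtain B1 where B1: "finite B1" "independent B1" "span B1 = V1"
      by (rule subspace_basis[OF V1 _ less.prems(1)]) (auto simp: V1_def)
    obtain B1' where B1': "finite B1'" "independent B1'" "span B1' = a ` ?V"
      by (rule subspace_basis[OF U less.prems(6,3)])
    have "card B1' < card B'"
    proof -
      obtain x where x: "x \<in> ?V'" "x \<notin> span B1'" using False less.prems(6) B1'(3) by blast
      then have "independent (insert x B1')" using B1'(2) independent_insertI[of x B1'] by blast
      moreover have "insert x B1' \<subseteq> ?V'"
        using x(1) B1'(3) less.prems(6) span_superset[of B1'] by blast
      ultimately have "card (insert x B1') \<le> card B'"
        using independent_span_bound[OF less.prems(3)] by simp
      moreover have "x \<notin> B1'" using x(2) span_base[of x B1'] by blast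
      ultimately show ?thesis using B1'(1) by simp
    qed
    moreover have "card B1 \<le> card B1'"
      using card_basis_vimage_le[OF less.prems(1,2) refl less.prems(3,4) refl less.prems(5,8) B1(2) _
          B1'(1,3)] B1(3) unfolding V1_def by blast
    moreover have "a ` span B1 \<subseteq> span B1'" "b ` span B1 \<subseteq> span B1'"
      unfolding B1(3) B1'(3) V1_def by auto
    moreover have "\<exists>v\<in>span B1. a v + b v = x" if "x \<in> span B1'" for x
    proof -
      obtain y where y: "y \<in> ?V" "x = a y" using \<open>x \<in> span B1'\<close> B1'(3) by blast
      \<comment> \<open>A solution of \<open>a v + b v = a y\<close> in \<open>V\<close> satisfies
        \<open>b v = a (y - v)\<close> and so lies in \<open>V1\<close>.\<close>
      then obtain v where v: "v \<in> ?V" "a v + b v = x" using less.prems(6,8) by blast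
      then have "b v = a (y - v)" using y(2) by (simp add: a_simps algebra_simps)
      then have "v \<in> V1" unfolding V1_def using v(1) y(1) span_diff by auto
      then show ?thesis using v(2) B1(3) by blast
    qed
    ultimately obtain w1 where w1: "Vector_Spaces.linear scale scale w1" "w1 ` span B1' = span B1"
      "\<forall>v\<in>span B1. a (w1 (b v)) = b (w1 (a v))"
      using less.hyps[of B1' B1] B1(1,2) B1'(1,2) by blast
    show ?thesis
    proof (rule intertwiner_extend[OF subspace_span subspace_span less.prems(6,7,8) V1_def w1(1)])
      show "w1 ` a ` ?V = V1" using w1(2) B1(3) B1'(3) by simp
      show "a (w1 (b v)) = b (w1 (a v))" if "v \<in> V1" for v using w1(3) that B1(3) by simp
    qed
  qed
qed

end

section \<open>Conjugation on a quadratic extension\<close>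

context quadratic_extension_conj
begin

sublocale scalars: vector_space "\<lambda>a x. emb a * x"
  by unfold_locales (auto simp: algebra_simps hom_distribs)

text \<open>An element \<open>y\<close> outside of the base field is a root of a polynomial
  \<open>X\<^sup>2 - p X - q\<close>, whose other root is \<open>p - y\<close>.\<close>

lemma bar_cases: "bar y = y \<or> (\<exists>p. bar y = emb p - y)"
proof (cases "y \<in> range emb")
  case True
  then show ?thesis using bar_emb by auto
next
  case False
  obtain B where B: "scalars.independent B" "UNIV \<subseteq> scalars.span B" "card B = 2"
    using scalars.basis_exists[of UNIV] degree by metis
  \<comment> \<open>Infinite sets have cardinality 0, so cardinality 2 forces finiteness.\<close>
  have fin: "finite B" using B(3) by (metis card.infinite zero_neq_numeral)
  have bound: "card S \<le> 2" if "scalars.independent S" for S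
    using scalars.independent_span_bound[OF fin that] B by auto
  have ind1: "scalars.independent {1}" by simp
  have "y \<notin> scalars.span {1}" using False by (auto simp: scalars.span_singleton)
  then have ind2: "scalars.independent {y, 1}"
    using ind1 by (rule scalars.independent_insertI)
  have "y\<^sup>2 \<in> scalars.span {y, 1}"
  proof (rule ccontr)
    assume n: "y\<^sup>2 \<notin> scalars.span {y, 1}"
    then have "card {y\<^sup>2, y, 1} \<le> 2"
      using bound scalars.independent_insertI[OF _ ind2] by blast
    moreover have "y\<^sup>2 \<notin> {y, 1}" using n scalars.span_base[of "y\<^sup>2" "{y, 1}"] by blast
    moreover have "y \<noteq> 1" using False by (metis hom_one rangeI)
    ultimately show False by auto
  qed
  then obtain p where "y\<^sup>2 - emb p * y \<in> scalars.span {1}"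
    by (auto simp: scalars.span_breakdown_eq[of "y\<^sup>2"])
  then obtain q where q: "y\<^sup>2 - emb p * y = emb q"
    by (auto simp: scalars.span_singleton)
  have "bar (y\<^sup>2 - emb p * y) = emb q" using q bar_emb by simp
  then have "(bar y)\<^sup>2 - emb p * bar y = emb q" by (simp add: hom_distribs bar_emb)
  then have "(bar y)\<^sup>2 - emb p * bar y = y\<^sup>2 - emb p * y"
    using q by simp
  then have "(bar y - y) * (bar y - (emb p - y)) = 0"
    by (simp add: algebra_simps power2_eq_square)
  then show ?thesis by auto
qed

text \<open>An element that is not fixed goes to \<open>emb p - y\<close>; since
  \<open>emb p\<close> is fixed, a second conjugation gives \<open>emb p - bar y\<close>, which is
  \<open>y\<close>.\<close>

lemma bar_bar: "bar (bar y) = y"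
  using bar_cases[of y] by (auto simp: hom_distribs bar_emb)

lemma skew_element: "\<exists>\<delta>. \<delta> \<noteq> 0 \<and> bar \<delta> = - \<delta>"
proof -
  obtain x where "bar x \<noteq> x" using bar_nontrivial by fastforce
  then have "x - bar x \<noteq> 0 \<and> bar (x - bar x) = - (x - bar x)"
    by (simp add: hom_distribs bar_bar)
  then show ?thesis by blast
qed

text \<open>Carries the condition on the characteristic to the larger field, where two vectors will
  be averaged.\<close>

lemma two_neq_0:
  assumes "CHAR('f) \<noteq> 2"
  shows "(2 :: 'e) \<noteq> 0"
proof
  assume "(2 :: 'e) = 0"
  then have "emb 2 = emb 0" by (simp add: hom_distribs)
  then have "of_nat 2 = (0 :: 'f)" by simp
  then have "CHAR('f) dvd 2" by (simp only: of_nat_eq_0_iff_char_dvd)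
  then have "0 < CHAR('f)" "CHAR('f) \<le> 2"
    using dvd_imp_le[of "CHAR('f)" 2] by (auto intro!: Nat.gr0I)
  moreover have "CHAR('f) \<noteq> 1" by simp
  ultimately show False using assms by linarith
qed

end

section \<open>From matrices to operators on functions\<close>

definition vec_ext :: "'a::zero vec \<Rightarrow> nat \<Rightarrow> 'a" where
  "vec_ext v = (\<lambda>i. if i < dim_vec v then v $ i else 0)"

lemma vec_vec_ext [simp]: "dim_vec v = n \<Longrightarrow> vec n (vec_ext v) = v"
  by (intro eq_vecI) (auto simp: vec_ext_def)

lemma sum_fun_apply: "(\<Sum>j\<in>A. f j) i = (\<Sum>j\<in>A. f j i)"
  by (induction A rule: infinite_finite_induct) auto

text \<open>Vectors of length \<open>n\<close> do not form a type. Extended by zero through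
  \<open>vec_ext\<close> they become a subspace of this space, where linear algebra over a type
  applies.\<close>

interpretation nat_fun: vector_space "\<lambda>(c::'k::field) (f::nat \<Rightarrow> 'k) i. c * f i"
  by unfold_locales (auto simp: algebra_simps)

text \<open>The case of \<open>intertwiner_exists\<close> in which source and target are both E^n,
  so that the dimension bound is an equality. Surjectivity of \<open>w\<close> yields the right
  inverse \<open>X\<close>.\<close>

lemma semilinear_intertwiner_mat:
  fixes bar :: "'e::field \<Rightarrow> 'e" and \<alpha> \<beta> :: "'e mat"
  assumes bar: "field_hom bar" "surj bar"
    and \<alpha>: "\<alpha> \<in> carrier_mat n n" and \<beta>: "\<beta> \<in> carrier_mat n n"
    and sum: "\<And>x. x \<in> carrier_vec n \<Longrightarrow>
      \<exists>v\<in>carrier_vec n. \<alpha> *\<^sub>v v + \<beta> *\<^sub>v map_vec bar v = x"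
  shows "\<exists>W X. W \<in> carrier_mat n n \<and> X \<in> carrier_mat n n \<and> W * X = 1\<^sub>m n \<and>
    \<alpha> * (W * \<beta>) = \<beta> * map_mat bar (W * \<alpha>)"
proof -
  interpret bar: field_hom bar by fact
  define a where "a f = vec_ext (\<alpha> *\<^sub>v vec n f)" for f
  define b where "b f = vec_ext (\<beta> *\<^sub>v map_vec bar (vec n f))" for f
  have entry_a: "a f i = (if i < n then \<Sum>j<n. \<alpha> $$ (i, j) * f j else 0)" for f i
    using \<alpha> by (auto simp: a_def vec_ext_def scalar_prod_def atLeast0LessThan)
  have entry_b: "b f i = (if i < n then \<Sum>j<n. \<beta> $$ (i, j) * bar (f j) else 0)" for f i
    using \<beta> by (auto simp: b_def vec_ext_def scalar_prod_def atLeast0LessThan)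
  have "Vector_Spaces.linear (\<lambda>c f i. c * f i) (\<lambda>c f i. c * f i) a"
    by unfold_locales (auto simp: entry_a fun_eq_iff algebra_simps sum.distrib sum_distrib_left)
  then interpret antilinear_pair "\<lambda>c (f::nat \<Rightarrow> 'e) i. c * f i" bar a b
    by (intro antilinear_pair.intro antilinear_pair_axioms.intro nat_fun.vector_space_axioms bar(2))
      (auto simp: entry_b fun_eq_iff algebra_simps sum.distrib sum_distrib_left
        bar.hom_add bar.hom_mult)
  define V :: "(nat \<Rightarrow> 'e) set" where "V = {f. \<forall>i\<ge>n. f i = 0}"
  define e :: "nat \<Rightarrow> nat \<Rightarrow> 'e" where "e j = (\<lambda>i. if i = j then 1 else 0)" for j
  have V: "nat_fun.subspace V" by (auto simp: V_def nat_fun.subspace_def)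
  have expand: "f = (\<Sum>j<n. (\<lambda>i. f j * e j i))" if "f \<in> V" for f
  proof
    fix i show "f i = (\<Sum>j<n. (\<lambda>i. f j * e j i)) i"
      using that by (auto simp: V_def e_def if_distrib[of "\<lambda>x. _ * x"]
          sum.delta' sum_fun_apply cong: if_cong)
  qed
  have "V \<subseteq> nat_fun.span (e ` {..<n})"
  proof
    fix f assume f: "f \<in> V"
    have "(\<Sum>j<n. (\<lambda>i. f j * e j i)) \<in> nat_fun.span (e ` {..<n})"
      by (intro nat_fun.span_sum nat_fun.span_scale nat_fun.span_base) auto
    then show "f \<in> nat_fun.span (e ` {..<n})" using expand[OF f] by simp
  qed
  then obtain B where B: "finite B" "nat_fun.independent B" "nat_fun.span B = V"
    using nat_fun.subspace_basis[OF V] by (metis finite_imageI finite_lessThan)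
  have ext_V: "vec_ext v \<in> V" if "v \<in> carrier_vec n" for v :: "'e vec"
    using that by (auto simp: V_def vec_ext_def)
  have V_ext: "vec_ext (vec n f) = f" if "f \<in> V" for f
    using that by (auto simp: V_def vec_ext_def)
  have aV: "a f \<in> V" and bV: "b f \<in> V" for f
    by (auto simp: V_def entry_a entry_b)
  have "\<exists>v\<in>V. a v + b v = x" if "x \<in> V" for x
  proof -
    obtain v where v: "v \<in> carrier_vec n" "\<alpha> *\<^sub>v v + \<beta> *\<^sub>v map_vec bar v = vec n x"
      using sum[of "vec n x"] by auto
    have "a (vec_ext v) + b (vec_ext v) = vec_ext (vec n x)"
      unfolding v(2)[symmetric] a_def b_def vec_vec_ext[OF carrier_vecD[OF v(1)]] using \<alpha> \<beta>
      by (auto simp: vec_ext_def fun_eq_iff)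
    then show ?thesis using ext_V[OF v(1)] V_ext[OF that] by auto
  qed
  then obtain w where w: "Vector_Spaces.linear (\<lambda>c f i. c * f i) (\<lambda>c f i. c * f i) w"
      "w ` V = V" "\<And>v. v \<in> V \<Longrightarrow> a (w (b v)) = b (w (a v))"
    using intertwiner_exists[OF B(1,2,1,2) order_refl] aV bV unfolding B(3) by blast
  define W where "W = mat n n (\<lambda>(i, j). w (e j) i)"
  have W: "W \<in> carrier_mat n n" unfolding W_def by simp
  have w_mat: "vec n (w f) = W *\<^sub>v vec n f" if "f \<in> V" for f
  proof -
    have "w f = (\<Sum>j<n. w (\<lambda>i. f j * e j i))"
      by (subst expand[OF that]) (rule endo.linear_sum[OF w(1)])
    also have "\<dots> = (\<Sum>j<n. (\<lambda>i. f j * w (e j) i))"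
      using endo.linear_scale[OF w(1)] by simp
    finally show ?thesis
      by (intro eq_vecI)
        (auto simp: W_def scalar_prod_def atLeast0LessThan sum_fun_apply mult.commute)
  qed
  have e_V: "e j \<in> V" and vec_e: "vec n (e j) = unit_vec n j" if "j < n" for j
    using that by (auto simp: V_def e_def unit_vec_def)
  \<comment> \<open>Preimages of the unit vectors under \<open>w\<close> serve as the columns of
    \<open>X\<close>.\<close>
  have "\<forall>j. \<exists>f. j < n \<longrightarrow> f \<in> V \<and> w f = e j"
    using w(2) e_V by (metis imageE)
  then obtain p where p: "\<And>j. j < n \<Longrightarrow> p j \<in> V \<and> w (p j) = e j" by metis
  define X where "X = mat n n (\<lambda>(i, j). p j i)"
  have X: "X \<in> carrier_mat n n" unfolding X_def by simp
  have "W * X = 1\<^sub>m n"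
  proof (rule mat_col_eqI)
    fix j assume "j < dim_col (1\<^sub>m n :: 'e mat)"
    then have j: "j < n" by simp
    have "col X j = vec n (p j)" using j by (auto simp: X_def)
    then have "col (W * X) j = vec n (w (p j))"
      using w_mat[of "p j"] p[OF j] j W X by (simp add: col_mult2)
    then show "col (W * X) j = col (1\<^sub>m n) j" using p[OF j] vec_e[OF j] j by simp
  qed (use W X in auto)
  \<comment> \<open>\<open>bar\<close> fixes the entries 0 and 1 of \<open>e j\<close>, so
    evaluating both antilinear maps at \<open>e j\<close> gives the \<open>j\<close>-th columns of
    the two matrices.\<close>
  moreover have "\<alpha> * (W * \<beta>) = \<beta> * map_mat bar (W * \<alpha>)"
  proof (rule mat_col_eqI)
    fix j assume "j < dim_col (\<beta> * map_mat bar (W * \<alpha>))"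
    then have j: "j < n" using \<alpha> by simp
    have cb: "vec n (b (e j)) = col \<beta> j"
      using j \<beta> by (auto simp: entry_b e_def if_distrib[of bar]
          if_distrib[of "\<lambda>x. _ * x"] sum.delta cong: if_cong)
    have ca: "vec n (a (e j)) = col \<alpha> j"
      using j \<alpha> by (auto simp: entry_a e_def
          if_distrib[of "\<lambda>x. _ * x"] sum.delta cong: if_cong)
    have "col (\<alpha> * (W * \<beta>)) j = \<alpha> *\<^sub>v vec n (w (b (e j)))"
      using j \<alpha> \<beta> W w_mat[OF bV] cb by (simp add: col_mult2[of _ n n _ n])
    also have "\<dots> = vec n (a (w (b (e j))))"
      using \<alpha> by (simp add: a_def)
    also have "\<dots> = vec n (b (w (a (e j))))" using w(3) e_V[OF j] by simp
    also have "\<dots> = \<beta> *\<^sub>v map_vec bar (W *\<^sub>v col \<alpha> j)"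
      using \<beta> w_mat[OF aV] ca by (simp add: b_def)
    also have "\<dots> = col (\<beta> * map_mat bar (W * \<alpha>)) j"
      using j \<alpha> \<beta> W by (simp add: col_mult2[of _ n n _ n])
    finally show "col (\<alpha> * (W * \<beta>)) j = col (\<beta> * map_mat bar (W * \<alpha>)) j" .
  qed (use \<alpha> \<beta> W in auto)
  ultimately show ?thesis using W X by blast
qed

section \<open>Block matrices in the general linear group\<close>

lemma carrier_GL: "carrier (GL TYPE('a::field) m) = Units (ring_mat TYPE('a) m ())"
  and mult_GL: "x \<otimes>\<^bsub>GL TYPE('a) m\<^esub> y = x * y"
  and one_GL: "\<one>\<^bsub>GL TYPE('a) m\<^esub> = 1\<^sub>m m"
  by (simp_all add: GL_def units_of_def ring_mat_simps)

lemma group_GL: "group (GL TYPE('a::field) m)"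
proof -
  interpret ring "ring_mat TYPE('a) m ()" by (rule ring_mat)
  show ?thesis unfolding GL_def by (rule units_group)
qed

lemma in_GL_iff:
  "x \<in> carrier (GL TYPE('a::field) m) \<longleftrightarrow>
    x \<in> carrier_mat m m \<and> (\<exists>y\<in>carrier_mat m m. x * y = 1\<^sub>m m)"
  by (auto simp: carrier_GL Units_def ring_mat_simps dest: mat_mult_left_right_inverse)

text \<open>The shape of the elements of \<open>H_set\<close>, kept apart from invertibility because
  g k g is first brought into this shape and its block is inverted afterwards.\<close>

definition twisted_diag :: "('e::field \<Rightarrow> 'e) \<Rightarrow> nat \<Rightarrow> 'e mat \<Rightarrow> 'e mat" where
  "twisted_diag bar n x = four_block_mat x (0\<^sub>m n n) (0\<^sub>m n n) (map_mat bar x)"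

lemma (in semiring_hom) map_mat_0: "map_mat hom (0\<^sub>m n m) = 0\<^sub>m n m"
  by (intro eq_matI) auto

lemma twisted_diag_mult:
  assumes "field_hom bar" "x \<in> carrier_mat n n" "y \<in> carrier_mat n n"
  shows "twisted_diag bar n x * twisted_diag bar n y = twisted_diag bar n (x * y)"
proof -
  interpret field_hom bar by fact
  show ?thesis
    unfolding twisted_diag_def using assms(2,3)
    by (subst mult_four_block_mat[of _ n n _ n _ n _ _ n _ n]) (auto simp: mat_hom_mult)
qed

lemma twisted_diag_in_H_set:
  fixes bar :: "'e::field \<Rightarrow> 'e"
  assumes "field_hom bar" and x: "x \<in> carrier_mat n n" and y: "y \<in> carrier_mat n n"
    and xy: "x * y = 1\<^sub>m n"
  shows "twisted_diag bar n x \<in> H_set bar n"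
proof -
  interpret field_hom bar by fact
  have "twisted_diag bar n x * twisted_diag bar n y = 1\<^sub>m (2 * n)"
    using twisted_diag_mult[OF assms(1) x y] xy by (simp add: twisted_diag_def mat_hom_one mult_2)
  moreover have "twisted_diag bar n z \<in> carrier_mat (2 * n) (2 * n)" if "z \<in> carrier_mat n n" for z
    using that by (simp add: twisted_diag_def mult_2)
  ultimately have "twisted_diag bar n x \<in> carrier (GL TYPE('e) (2 * n))"
    unfolding in_GL_iff using x y by blast
  \<comment> \<open>To match \<open>G_set\<close> with \<open>\<beta> = 0\<close>, the lower left
    zero block is written as the conjugate of the upper right one.\<close>
  moreover have "twisted_diag bar n x =
      four_block_mat x (0\<^sub>m n n) (map_mat bar (0\<^sub>m n n)) (map_mat bar x)"
    by (simp add: twisted_diag_def map_mat_0)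
  ultimately have "twisted_diag bar n x \<in> G_set bar n"
    unfolding G_set_def using x zero_carrier_mat[of n n] by blast
  then show ?thesis
    unfolding H_set_def using x by (auto simp: twisted_diag_def)
qed

text \<open>Solving with \<open>g\<close> for the vector (x, bar x) gives a pair (v1, v2).
  Conjugating the second row shows that (bar v2, bar v1) solves the first row as well, and the mean
  of the two pairs has the form (m, bar m).\<close>

lemma semilinear_surj_if_in_G_set:
  fixes bar :: "'e::field \<Rightarrow> 'e"
  assumes bar: "field_hom bar" "\<And>y. bar (bar y) = y" and two: "(2 :: 'e) \<noteq> 0"
    and \<alpha>: "\<alpha> \<in> carrier_mat n n" and \<beta>: "\<beta> \<in> carrier_mat n n"
    and g: "four_block_mat \<alpha> \<beta> (map_mat bar \<beta>) (map_mat bar \<alpha>) \<in> carrier (GL TYPE('e) (2 * n))"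
    and x: "x \<in> carrier_vec n"
  shows "\<exists>v\<in>carrier_vec n. \<alpha> *\<^sub>v v + \<beta> *\<^sub>v map_vec bar v = x"
proof -
  interpret bar: field_hom bar by fact
  let ?g = "four_block_mat \<alpha> \<beta> (map_mat bar \<beta>) (map_mat bar \<alpha>)"
  let ?bv = "map_vec bar" and ?bm = "map_mat bar"
  obtain g' where g': "g' \<in> carrier_mat (2 * n) (2 * n)" "?g * g' = 1\<^sub>m (2 * n)"
    using g in_GL_iff by blast
  have gc: "?g \<in> carrier_mat (2 * n) (2 * n)" using g in_GL_iff by blast
  define z where "z = x @\<^sub>v ?bv x"
  have z: "z \<in> carrier_vec (2 * n)" using x by (simp add: z_def mult_2)
  define v1 where "v1 = vec_first (g' *\<^sub>v z) n"
  define v2 where "v2 = vec_last (g' *\<^sub>v z) n"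
  have v1: "v1 \<in> carrier_vec n" and v2: "v2 \<in> carrier_vec n" by (simp_all add: v1_def v2_def)
  have "v1 @\<^sub>v v2 = g' *\<^sub>v z"
    unfolding v1_def v2_def using g'(1) z by (intro vec_first_last_append) (simp add: mult_2[symmetric])
  then have "?g *\<^sub>v (v1 @\<^sub>v v2) = z"
    using assoc_mult_mat_vec[OF gc g'(1) z] g'(2) z by simp
  then have "(\<alpha> *\<^sub>v v1 + \<beta> *\<^sub>v v2) @\<^sub>v (?bm \<beta> *\<^sub>v v1 + ?bm \<alpha> *\<^sub>v v2) = x @\<^sub>v ?bv x"
    unfolding z_def using four_block_mat_mult_vec[of \<alpha> n n \<beta> n "?bm \<beta>" n "?bm \<alpha>" v1 v2]
      \<alpha> \<beta> v1 v2 by simp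
  then have eqs: "\<alpha> *\<^sub>v v1 + \<beta> *\<^sub>v v2 = x" "?bm \<beta> *\<^sub>v v1 + ?bm \<alpha> *\<^sub>v v2 = ?bv x"
    using append_vec_eq[of "\<alpha> *\<^sub>v v1 + \<beta> *\<^sub>v v2" n x] \<alpha> \<beta> x v1 v2 by auto
  have bvbv: "?bv (?bv v) = v" for v by (intro eq_vecI) (auto simp: bar(2))
  have bmbm: "?bm (?bm m) = m" for m by (intro eq_matI) (auto simp: bar(2))
  have bv_add: "?bv (u + v) = ?bv u + ?bv v" if "u \<in> carrier_vec n" "v \<in> carrier_vec n" for u v
    using that by (intro eq_vecI) (auto simp: bar.hom_add)
  have "?bv (?bm \<beta> *\<^sub>v v1 + ?bm \<alpha> *\<^sub>v v2) = x" using eqs(2) bvbv by simp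
  then have eq3: "\<beta> *\<^sub>v ?bv v1 + \<alpha> *\<^sub>v ?bv v2 = x"
    using \<alpha> \<beta> v1 v2 by (simp add: bv_add bar.mult_mat_vec_hom[of _ n n] bmbm)
  \<comment> \<open>The weight of the mean is one half, which \<open>bar\<close> fixes because 2 is
    a sum of ones.\<close>
  have "bar 2 = 2" by (metis bar.hom_add bar.hom_one one_add_one)
  then have "bar (inverse 2) = inverse 2" by (simp only: bar.hom_inverse)
  moreover have "inverse 2 + inverse 2 = (1 :: 'e)"
    using two by (simp add: field_simps)
  ultimately obtain c where c: "bar c = c" "c + c = 1" by blast
  define m where "m = c \<cdot>\<^sub>v (v1 + ?bv v2)"
  have bm: "?bv m = c \<cdot>\<^sub>v (?bv v1 + v2)"
    using v1 v2 by (intro eq_vecI) (auto simp: m_def bar.hom_mult bar.hom_add bar(2) c(1))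
  have "\<alpha> *\<^sub>v m + \<beta> *\<^sub>v ?bv m =
      c \<cdot>\<^sub>v (\<alpha> *\<^sub>v v1 + \<beta> *\<^sub>v v2) + c \<cdot>\<^sub>v (\<beta> *\<^sub>v ?bv v1 + \<alpha> *\<^sub>v ?bv v2)"
    unfolding bm unfolding m_def using \<alpha> \<beta> v1 v2
    by (intro eq_vecI)
      (auto simp: mult_mat_vec[of _ n n] mult_add_distrib_mat_vec[of _ n n] algebra_simps)
  also have "\<dots> = x"
    unfolding eqs eq3 add_smult_distrib_vec[symmetric] c(2) by simp
  finally show ?thesis using v1 v2 by (auto simp: m_def)
qed

text \<open>The upper right block of the product is \<open>\<delta>\<close> times \<open>\<alpha> *
  (W * \<beta>) - \<beta> * map_mat bar (W * \<alpha>)\<close>, the minus sign coming from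
  \<open>bar \<delta> = - \<delta>\<close>. The lower blocks are the conjugates of the upper
  ones.\<close>

lemma twisted_conjugate_in_H:
  fixes bar :: "'e::field \<Rightarrow> 'e"
  assumes bar: "field_hom bar" "\<And>y. bar (bar y) = y" and \<delta>: "bar \<delta> = - \<delta>"
    and \<alpha>: "\<alpha> \<in> carrier_mat n n" and \<beta>: "\<beta> \<in> carrier_mat n n" and W: "W \<in> carrier_mat n n"
    and W_eq: "\<alpha> * (W * \<beta>) = \<beta> * map_mat bar (W * \<alpha>)"
    and g: "g = four_block_mat \<alpha> \<beta> (map_mat bar \<beta>) (map_mat bar \<alpha>)"
  shows "\<exists>y\<in>carrier_mat n n. g * (twisted_diag bar n (\<delta> \<cdot>\<^sub>m W) * g) = twisted_diag bar n y"
proof -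
  interpret bar: field_hom bar by fact
  let ?bm = "map_mat bar"
  define x where "x = \<delta> \<cdot>\<^sub>m W"
  have x: "x \<in> carrier_mat n n" using W by (simp add: x_def)
  have bmbm: "?bm (?bm m) = m" for m by (intro eq_matI) (auto simp: bar(2))
  have bm_add: "?bm (p + q) = ?bm p + ?bm q" if "p \<in> carrier_mat n n" "q \<in> carrier_mat n n" for p q
    using that by (intro eq_matI) (auto simp: bar.hom_add)
  have bx: "?bm x = (- \<delta>) \<cdot>\<^sub>m ?bm W"
    using W by (intro eq_matI) (auto simp: x_def bar.hom_mult \<delta>)
  define y where "y = \<alpha> * (x * \<alpha>) + \<beta> * (?bm x * ?bm \<beta>)"
  have y: "y \<in> carrier_mat n n" using \<alpha> \<beta> x by (simp add: y_def)
  have b_y: "?bm y = ?bm \<beta> * (x * \<beta>) + ?bm \<alpha> * (?bm x * ?bm \<alpha>)"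
    unfolding y_def using \<alpha> \<beta> x
    by (simp add: bm_add bar.mat_hom_mult[of _ n n _ n] bmbm comm_add_mat[of _ n n])
  have "\<alpha> * (x * \<beta>) = \<delta> \<cdot>\<^sub>m (\<alpha> * (W * \<beta>))"
    unfolding x_def using \<alpha> \<beta> W
    by (simp add: mult_smult_distrib[of _ n n _ n] mult_smult_assoc_mat[of _ n n _ n])
  moreover have "\<beta> * (?bm x * ?bm \<alpha>) = (- \<delta>) \<cdot>\<^sub>m (\<alpha> * (W * \<beta>))"
    unfolding bx W_eq using \<alpha> \<beta> W
    by (simp add: mult_smult_distrib[of _ n n _ n] mult_smult_assoc_mat[of _ n n _ n]
        bar.mat_hom_mult[of _ n n _ n])
  ultimately have off: "\<alpha> * (x * \<beta>) + \<beta> * (?bm x * ?bm \<alpha>) = 0\<^sub>m n n"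
    using \<alpha> \<beta> W by (intro eq_matI) auto
  have "?bm (\<alpha> * (x * \<beta>) + \<beta> * (?bm x * ?bm \<alpha>)) = 0\<^sub>m n n"
    unfolding off by (rule bar.map_mat_0)
  then have off': "?bm \<beta> * (x * \<alpha>) + ?bm \<alpha> * (?bm x * ?bm \<beta>) = 0\<^sub>m n n"
    using \<alpha> \<beta> x
    by (simp add: bm_add bar.mat_hom_mult[of _ n n _ n] bmbm comm_add_mat[of _ n n])
  have "twisted_diag bar n x * g =
      four_block_mat (x * \<alpha>) (x * \<beta>) (?bm x * ?bm \<beta>) (?bm x * ?bm \<alpha>)"
    unfolding g twisted_diag_def using \<alpha> \<beta> x
    by (subst mult_four_block_mat[of _ n n _ n _ n _ _ n _ n]) auto
  then have "g * (twisted_diag bar n x * g) = twisted_diag bar n y"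
    unfolding g using \<alpha> \<beta> x
    by (simp add: mult_four_block_mat[of _ n n _ n _ n _ _ n _ n] twisted_diag_def off off' b_y
        y_def[symmetric])
  then show ?thesis using y unfolding x_def by blast
qed

text \<open>The determinant is the product of those of the two diagonal blocks, so neither factor
  vanishes.\<close>

lemma invertible_if_twisted_diag_in_GL:
  assumes x: "x \<in> carrier_mat n n" and D: "twisted_diag bar n x \<in> carrier (GL TYPE('e::field) (2 * n))"
  shows "\<exists>y\<in>carrier_mat n n. x * y = 1\<^sub>m n"
proof -
  have "det (twisted_diag bar n x) = det x * det (map_mat bar x)"
    unfolding twisted_diag_def using x by (intro det_four_block_mat_upper_right_zero) auto
  moreover have "det (twisted_diag bar n x) \<noteq> 0"
    by (rule unit_imp_det_non_zero[OF D[unfolded carrier_GL]])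
  ultimately have "x \<in> Units (ring_mat TYPE('e) n ())"
    using det_non_zero_imp_unit[OF x] by auto
  then show ?thesis using in_GL_iff carrier_GL by metis
qed

section \<open>The inverse as an element of the double coset\<close>

theorem proposition4p5:
  fixes absv :: "'f::field \<Rightarrow> real"
    and emb :: "'f \<Rightarrow> 'e::field"
    and bar :: "'e \<Rightarrow> 'e"
    and n :: nat
    and g :: "'e mat"
  assumes "nonarch_local_field absv"
    and "CHAR('f) \<noteq> 2"
    and "quadratic_extension_conj emb bar"
    and "n \<ge> 1"
    and "g \<in> G_set bar n"
  shows "inv\<^bsub>GL TYPE('e) (2 * n)\<^esub> g \<in> double_coset (GL TYPE('e) (2 * n)) (H_set bar n) g"
proof -
  interpret quadratic_extension_conj emb bar by fact
  interpret group "GL TYPE('e) (2 * n)" by (rule group_GL)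
  note bar_hom = bar.field_hom_axioms
  let ?D = "twisted_diag bar n" and ?GL = "GL TYPE('e) (2 * n)"
  obtain \<alpha> \<beta> where ab: "\<alpha> \<in> carrier_mat n n" "\<beta> \<in> carrier_mat n n"
    and g: "g = four_block_mat \<alpha> \<beta> (map_mat bar \<beta>) (map_mat bar \<alpha>)"
    and g_GL: "g \<in> carrier (GL TYPE('e) (2 * n))"
    using assms(5) unfolding G_set_def by blast
  obtain \<delta> where \<delta>: "\<delta> \<noteq> 0" "bar \<delta> = - \<delta>" using skew_element by blast
  have sum: "\<exists>v\<in>carrier_vec n. \<alpha> *\<^sub>v v + \<beta> *\<^sub>v map_vec bar v = x" if "x \<in> carrier_vec n" for x
    using semilinear_surj_if_in_G_set[OF bar_hom bar_bar two_neq_0[OF assms(2)] ab _ that] g g_GL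
    by simp
  obtain W X where W: "W \<in> carrier_mat n n" and X: "X \<in> carrier_mat n n" and WX: "W * X = 1\<^sub>m n"
    and W_eq: "\<alpha> * (W * \<beta>) = \<beta> * map_mat bar (W * \<alpha>)"
    using semilinear_intertwiner_mat[OF bar_hom bij_is_surj[OF bar_bij] ab sum] by blast
  define k where "k = ?D (\<delta> \<cdot>\<^sub>m W)"
  \<comment> \<open>Membership of \<open>k\<close> in \<open>H_set\<close> needs an explicit right
    inverse of its upper block.\<close>
  have "(\<delta> \<cdot>\<^sub>m W) * (inverse \<delta> \<cdot>\<^sub>m X) = inverse \<delta> \<cdot>\<^sub>m (\<delta> \<cdot>\<^sub>m (W * X))"
    using W X by (simp add: mult_smult_distrib[of _ n n _ n] mult_smult_assoc_mat[of _ n n _ n])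
  also have "\<dots> = 1\<^sub>m n" using \<delta>(1) WX by (intro eq_matI) auto
  finally have k: "k \<in> H_set bar n"
    unfolding k_def using W X
    by (intro twisted_diag_in_H_set[OF bar_hom, where y = "inverse \<delta> \<cdot>\<^sub>m X"]) auto
  have H_GL: "h \<in> carrier (GL TYPE('e) (2 * n))" if "h \<in> H_set bar n" for h
    using that unfolding H_set_def G_set_def by blast
  obtain y where y: "y \<in> carrier_mat n n" "g * (k * g) = ?D y"
    unfolding k_def using twisted_conjugate_in_H[OF bar_hom bar_bar \<delta>(2) ab W W_eq g] by blast
  \<comment> \<open>A product of invertible matrices is invertible, so the block \<open>y\<close>
    acquires an inverse \<open>z\<close>.\<close>
  have "?D y \<in> carrier (GL TYPE('e) (2 * n))"
    using m_closed[OF g_GL m_closed[OF H_GL[OF k] g_GL]] y(2) by (simp add: mult_GL)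
  then obtain z where z: "z \<in> carrier_mat n n" "y * z = 1\<^sub>m n"
    using invertible_if_twisted_diag_in_GL[OF y(1)] by blast
  have zy: "z * y = 1\<^sub>m n" by (rule mat_mult_left_right_inverse[OF y(1) z])
  have h: "?D z \<in> H_set bar n" by (rule twisted_diag_in_H_set[OF bar_hom z(1) y(1) zy])
  \<comment> \<open>\<open>?D z\<close> inverts g k g; regrouping the factors makes the product of
    \<open>?D z\<close>, \<open>g\<close> and \<open>k\<close> a left inverse of
    \<open>g\<close>.\<close>
  have "?D z * (g * (k * g)) = 1\<^sub>m (2 * n)"
    unfolding y(2) twisted_diag_mult[OF bar_hom z(1) y(1)] zy
    by (simp add: twisted_diag_def bar.mat_hom_one mult_2)
  then have "?D z \<otimes>\<^bsub>?GL\<^esub> (g \<otimes>\<^bsub>?GL\<^esub> (k \<otimes>\<^bsub>?GL\<^esub> g)) = \<one>\<^bsub>?GL\<^esub>"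
    by (simp only: mult_GL one_GL)
  then have "inv\<^bsub>?GL\<^esub> g = ?D z \<otimes>\<^bsub>?GL\<^esub> g \<otimes>\<^bsub>?GL\<^esub> k"
    using H_GL[OF h] H_GL[OF k] g_GL by (intro inv_equality) (simp_all add: m_assoc)
  then show ?thesis
    using h k unfolding double_coset_def r_coset_def set_mult_def by blast
qed

end
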